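(* Let $p$ be a prime and $\beta\ge1$. For $1\le i\le r$ let $A_i$ be a nonzero finite commutative $p$-group, let $A=\bigoplus_{i=1}^r A_i$, and let $B$ be a commutative group of exponent $p^\beta$. Then $$\delta(A,B)=\max_{\underline\beta}\sum_{i=1}^r \delta\big(A_i,\mathbb{Z}/p^{\beta_i+1}\mathbb{Z}\big),$$ where the maximum ranges over all $\underline\beta=(\beta_1,\dots,\beta_r)\in\mathbb N^r$ with $\beta_1+\dots+\beta_r=\beta-1$.
   Context: For commutative groups $A,B$, $B^A$ denotes the commutative group (under pointwise addition) of all maps $A\to B$. For $a\in A$, the difference operator $\Delta_a:B^A\to B^A$ is $(\Delta_a f)(x)=f(x+a)-f(x)$. Let $\widetilde{\mathbb N}=\mathbb N\cup\{-\infty,\infty\}$ ($\mathbb N=\{0,1,2,\dots\}$), totally ordered with $-\infty$ least and $\infty$ greatest. The functional degree $\operatorname{fdeg}(f)\in\widetilde{\mathbb N}$ of $f\in B^A$ is: $-\infty$ if $f=0$; otherwise the least $n\in\mathbb N$ such that $\Delta_{a_1}\cdots\Delta_{a_{n+1}}f=0$ for all $a_1,\dots,a_{n+1}\in A$; and $\infty$ if no such $n$ exists. Define $\delta(A,B)=\sup\{\operatorname{fdeg}(f): f\in B^A\}$. *)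

theory Defs
  imports "HOL-Algebra.Algebra" "HOL-Library.Extended_Real"
begin

text \<open>Commutative groups are HOL-Algebra structures (written multiplicatively).
  Maps A -> B are functions on the carriers; B^A is taken to be the set of
  extensional maps from carrier A to carrier B.\<close>

definition diffop :: "('a, 'c) monoid_scheme \<Rightarrow> ('b, 'd) monoid_scheme \<Rightarrow> 'a \<Rightarrow> ('a \<Rightarrow> 'b) \<Rightarrow> ('a \<Rightarrow> 'b)"
  where "diffop A B a f = (\<lambda>x\<in>carrier A. f (x \<otimes>\<^bsub>A\<^esub> a) \<otimes>\<^bsub>B\<^esub> inv\<^bsub>B\<^esub> (f x))"

fun diffops :: "('a, 'c) monoid_scheme \<Rightarrow> ('b, 'd) monoid_scheme \<Rightarrow> 'a list \<Rightarrow> ('a \<Rightarrow> 'b) \<Rightarrow> ('a \<Rightarrow> 'b)"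
  where "diffops A B [] f = f"
  | "diffops A B (a # as) f = diffop A B a (diffops A B as f)"

definition is_zero_map :: "('a, 'c) monoid_scheme \<Rightarrow> ('b, 'd) monoid_scheme \<Rightarrow> ('a \<Rightarrow> 'b) \<Rightarrow> bool"
  where "is_zero_map A B f \<longleftrightarrow> (\<forall>x\<in>carrier A. f x = \<one>\<^bsub>B\<^esub>)"

definition kills :: "('a, 'c) monoid_scheme \<Rightarrow> ('b, 'd) monoid_scheme \<Rightarrow> ('a \<Rightarrow> 'b) \<Rightarrow> nat \<Rightarrow> bool"
  where "kills A B f n \<longleftrightarrow>
     (\<forall>as. length as = Suc n \<and> set as \<subseteq> carrier A \<longrightarrow> is_zero_map A B (diffops A B as f))"

definition fdeg :: "('a, 'c) monoid_scheme \<Rightarrow> ('b, 'd) monoid_scheme \<Rightarrow> ('a \<Rightarrow> 'b) \<Rightarrow> ereal"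
  where "fdeg A B f =
    (if is_zero_map A B f then -\<infinity>
     else if (\<exists>n. kills A B f n) then ereal (real (LEAST n. kills A B f n))
     else \<infinity>)"

definition delta :: "('a, 'c) monoid_scheme \<Rightarrow> ('b, 'd) monoid_scheme \<Rightarrow> ereal"
  where "delta A B = (SUP f \<in> carrier A \<rightarrow>\<^sub>E carrier B. fdeg A B f)"

definition group_exponent :: "('b, 'd) monoid_scheme \<Rightarrow> nat"
  where "group_exponent B =
     (if \<exists>n>0. \<forall>x\<in>carrier B. x [^]\<^bsub>B\<^esub> (n::nat) = \<one>\<^bsub>B\<^esub>
      then (LEAST n. n > 0 \<and> (\<forall>x\<in>carrier B. x [^]\<^bsub>B\<^esub> (n::nat) = \<one>\<^bsub>B\<^esub>)) else 0)"

end

theory Submission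
  imports Defs
begin

text \<open>
  A map on \<open>A\<close> with values in a group of exponent \<open>e\<close> is killed by all \<open>n\<close>-fold differences iff it
  vanishes on the \<open>n\<close>-th power \<open>J\<^sup>n\<close> of the augmentation ideal of the integral group ring of \<open>A\<close>,
  so \<open>\<delta>(A,B)\<close> is the largest \<open>n\<close> for which \<open>J\<^sup>n\<close> is not divisible by \<open>e\<close>.
  For \<open>A = \<Oplus>\<^sub>i A\<^sub>i\<close> the ideal \<open>J\<^sup>n\<close> is spanned by translates of pure tensors \<open>\<Otimes>\<^sub>i u\<^sub>i\<close> with
  \<open>u\<^sub>i \<in> J\<^sub>i\<^bsup>n(i)\<^esup>\<close> and \<open>\<Sum>\<^sub>i n(i) = n\<close>, and the coefficients of a pure tensor are the products of the
  coefficients of the \<open>u\<^sub>i\<close>. Hence the \<open>p\<close>-adic valuations add up, and distributing \<open>\<beta> - 1\<close> among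
  the summands gives the formula.
\<close>

section \<open>Iterated differences of integer-valued maps on a group\<close>

definition zdiff :: "('a, 'c) monoid_scheme \<Rightarrow> 'a \<Rightarrow> ('a \<Rightarrow> int) \<Rightarrow> 'a \<Rightarrow> int"
  where "zdiff A a f = (\<lambda>x. f (x \<otimes>\<^bsub>A\<^esub> a) - f x)"

definition zdiffs :: "('a, 'c) monoid_scheme \<Rightarrow> 'a list \<Rightarrow> ('a \<Rightarrow> int) \<Rightarrow> 'a \<Rightarrow> int"
  where "zdiffs A as f = foldr (zdiff A) as f"

definition point :: "'a \<Rightarrow> 'a \<Rightarrow> int"
  where "point z x = of_bool (x = z)"

text \<open>The values \<open>zdiffs A as (point z) x\<close> are, up to translation and inversion of the argument,
  the coefficients of the product of the \<open>a - 1\<close>, \<open>a \<in> set as\<close>, in the integral group ring.\<close>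
definition survives :: "('a, 'c) monoid_scheme \<Rightarrow> int \<Rightarrow> nat \<Rightarrow> bool"
  where "survives A m n \<longleftrightarrow>
    (\<exists>as. length as = n \<and> set as \<subseteq> carrier A \<and>
      (\<exists>x\<in>carrier A. \<exists>z\<in>carrier A. \<not> m dvd zdiffs A as (point z) x))"

lemma zdiffs_Nil [simp]: "zdiffs A [] f = f"
  and zdiffs_Cons [simp]: "zdiffs A (a # as) f = zdiff A a (zdiffs A as f)"
  and zdiffs_append: "zdiffs A (as @ bs) f = zdiffs A as (zdiffs A bs f)"
  by (simp_all add: zdiffs_def)

context comm_group
begin

lemma zdiffs_cong:
  assumes "set as \<subseteq> carrier G" "\<And>x. x \<in> carrier G \<Longrightarrow> f x = g x" "x \<in> carrier G"
  shows "zdiffs G as f x = zdiffs G as g x"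
  using assms(1,3) by (induction as arbitrary: x) (auto simp: zdiff_def assms(2))

lemma zdiffs_zdiff_commute:
  assumes "set as \<subseteq> carrier G" "a \<in> carrier G" "x \<in> carrier G"
  shows "zdiffs G as (zdiff G a f) x = zdiff G a (zdiffs G as f) x"
  using assms(1,3) by (induction as arbitrary: x) (auto simp: zdiff_def assms(2) m_ac)

lemma zdiffs_cmult:
  "zdiffs G as (\<lambda>x. c * f x) x = c * zdiffs G as f x"
  by (induction as arbitrary: x) (auto simp: zdiff_def algebra_simps)

text \<open>Differences commute, so the list may be reordered; this serves to gather all copies of
  one element in a single block.\<close>

lemma zdiffs_partition:
  assumes "set as \<subseteq> carrier G" "x \<in> carrier G"
  shows "zdiffs G as f x = zdiffs G (filter P as @ filter (\<lambda>a. \<not> P a) as) f x"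
  using assms
proof (induction as arbitrary: x)
  case (Cons a as)
  let ?ps = "filter P as" and ?ns = "filter (\<lambda>a. \<not> P a) as"
  have step: "zdiffs G (a # as) f x = zdiff G a (zdiffs G (?ps @ ?ns) f) x"
    using Cons by (simp add: zdiff_def)
  also have "\<dots> = zdiffs G ?ps (zdiff G a (zdiffs G ?ns f)) x"
    using Cons.prems by (subst zdiffs_zdiff_commute) (auto simp: zdiffs_append)
  finally show ?case
    using step by (simp add: zdiffs_append)
qed simp

text \<open>The binomial expansion of (T - 1)^q with T the translation by \<open>a\<close>. Writing
  the sign with \<open>q + j\<close> avoids truncated subtraction on \<open>nat\<close>.\<close>

lemma zdiffs_replicate:
  assumes "a \<in> carrier G" "x \<in> carrier G"
  shows "zdiffs G (replicate q a) f x
    = (\<Sum>j\<le>q. (-1) ^ (q + j) * int (q choose j) * f (x \<otimes> a [^] j))"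
  using assms(2)
proof (induction q arbitrary: x)
  case (Suc q)
  let ?g = "\<lambda>j::nat. f (x \<otimes> a [^] j)"
  have shift: "x \<otimes> a \<otimes> a [^] j = x \<otimes> a [^] Suc j" for j
    using assms(1) Suc.prems by (simp add: m_ac nat_pow_Suc del: nat_pow_Suc2)
  have "zdiffs G (replicate (Suc q) a) f x =
      (\<Sum>j\<le>q. (-1) ^ (q + j) * int (q choose j) * ?g (Suc j))
      - (\<Sum>j\<le>q. (-1) ^ (q + j) * int (q choose j) * ?g j)"
    using Suc assms(1) by (simp add: zdiff_def shift del: nat_pow_Suc)
  \<comment> \<open>The added term vanishes as \<open>q choose Suc q = 0\<close>. Once the term at 0
    is split off, both sums run over \<open>Suc j\<close> and Pascal's rule merges them.\<close>
  also have "(\<Sum>j\<le>q. (-1) ^ (q + j) * int (q choose j) * ?g j)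
      = (\<Sum>j\<le>Suc q. (-1) ^ (q + j) * int (q choose j) * ?g j)"
    by (simp del: nat_pow_Suc)
  also have "\<dots> = (-1) ^ q * ?g 0
      - (\<Sum>j\<le>q. (-1) ^ (q + j) * int (q choose Suc j) * ?g (Suc j))"
    by (subst sum.atMost_Suc_shift) (simp add: sum_negf del: nat_pow_Suc)
  also have "(\<Sum>j\<le>q. (-1) ^ (q + j) * int (q choose j) * ?g (Suc j)) -
      ((-1) ^ q * ?g 0 - (\<Sum>j\<le>q. (-1) ^ (q + j) * int (q choose Suc j) * ?g (Suc j)))
      = (\<Sum>j\<le>Suc q. (-1) ^ (Suc q + j) * int (Suc q choose j) * ?g j)"
    by (subst sum.atMost_Suc_shift) (simp add: sum.distrib algebra_simps del: nat_pow_Suc)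
  finally show ?case .
qed (use assms in simp)

text \<open>Let T be the translation by \<open>a\<close> and q = \<open>p ^ k\<close>. Modulo
  \<open>p\<close>, Frobenius gives (T - 1)^q = T^q - 1, and T^q is the identity.\<close>

lemma prime_dvd_zdiffs_replicate:
  assumes "Factorial_Ring.prime p" "a \<in> carrier G" "x \<in> carrier G" "a [^] (p ^ k) = \<one>"
  shows "int p dvd zdiffs G (replicate (p ^ k) a) f x"
proof -
  let ?q = "p ^ k" and ?c = "\<lambda>j. (-1) ^ (p ^ k + j) * int (p ^ k choose j) * f (x \<otimes> a [^] j)"
  have "p > 1" using assms(1) by (rule prime_gt_1_nat)
  then have "?q > 0" by simp
  have mid: "int p dvd ?c j" if "j \<in> {0<..<?q}" for j
  proof -
    \<comment> \<open>Otherwise \<open>?q\<close> is coprime to the binomial coefficient, and the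
      absorption identity forces \<open>?q dvd j\<close>, impossible for
      \<open>0 < j < ?q\<close>.\<close>
    have "p dvd ?q choose j"
    proof (rule ccontr)
      assume "\<not> p dvd ?q choose j"
      then have "coprime ?q (?q choose j)"
        using assms(1) by (simp add: prime_imp_coprime)
      moreover have "j * (?q choose j) = ?q * (?q - 1 choose (j - 1))"
        using that by (intro times_binomial_minus1_eq) auto
      ultimately have "?q dvd j"
        by (metis coprime_dvd_mult_left_iff dvd_triv_left)
      with that show False by (auto dest: dvd_imp_le)
    qed
    then show ?thesis by (auto intro!: dvd_mult dvd_mult2)
  qed
  have "{..?q} = insert 0 (insert ?q {0<..<?q})"
    using \<open>?q > 0\<close> by auto
  then have "zdiffs G (replicate ?q a) f x = ?c 0 + ?c ?q + (\<Sum>j\<in>{0<..<?q}. ?c j)"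
    using \<open>?q > 0\<close> by (simp add: zdiffs_replicate assms)
  also have "?c 0 + ?c ?q = ((-1) ^ ?q + 1) * f x"
    using assms by (simp add: algebra_simps flip: power_add mult_2)
  finally have eq: "zdiffs G (replicate ?q a) f x = ((-1) ^ ?q + 1) * f x + (\<Sum>j\<in>{0<..<?q}. ?c j)" .
  \<comment> \<open>The two end terms cancel if \<open>?q\<close> is odd; if it is even, then
    \<open>p = 2\<close> and they add up to twice \<open>f x\<close>.\<close>
  have "int p dvd (-1) ^ ?q + 1"
  proof (cases "even ?q")
    case True
    then have "p = 2" using assms(1) primes_dvd_imp_eq[of 2 p] by (auto simp: two_is_prime_nat)
    with True show ?thesis by simp
  qed simp
  then show ?thesis unfolding eq using mid by (intro dvd_add[OF dvd_mult2 dvd_sum]) auto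
qed

text \<open>Pigeonhole: among \<open>p ^ k * p ^ k\<close> entries from \<open>p ^ k\<close>
  elements, one occurs at least \<open>p ^ k\<close> times. Its \<open>p ^ k\<close>-th power is
  trivial by Lagrange, so moving that many copies to the front yields the factor
  \<open>p\<close>.\<close>

lemma prime_dvd_zdiffs_long:
  assumes "Factorial_Ring.prime p" "finite (carrier G)" "order G = p ^ k"
    and "set as \<subseteq> carrier G" "length as \<ge> p ^ k * p ^ k" "x \<in> carrier G"
  shows "int p dvd zdiffs G as f x"
proof -
  have "\<exists>a\<in>carrier G. count_list as a \<ge> p ^ k"
  proof (rule ccontr)
    assume "\<not> ?thesis"
    then have "(\<Sum>a\<in>carrier G. count_list as a) < (\<Sum>a\<in>carrier G. p ^ k)"
      using assms(2) by (intro sum_strict_mono) (auto simp: not_le)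
    moreover have "(\<Sum>a\<in>carrier G. count_list as a) = length as"
      using assms(2,4) by (simp add: sum_count_set)
    ultimately show False
      using assms(3,5) by (simp add: order_def)
  qed
  then obtain a where a: "a \<in> carrier G" "count_list as a \<ge> p ^ k" by blast
  let ?rest = "replicate (count_list as a - p ^ k) a @ filter (\<lambda>b. b \<noteq> a) as"
  have "filter (\<lambda>b. b = a) as = replicate (count_list as a) a"
    by (induction as) auto
  also have "\<dots> = replicate (p ^ k) a @ replicate (count_list as a - p ^ k) a"
    using a(2) by (simp flip: replicate_add)
  finally have "zdiffs G as f x = zdiffs G (replicate (p ^ k) a) (zdiffs G ?rest f) x"
    using zdiffs_partition[OF assms(4,6), of f "\<lambda>b. b = a"] by (simp add: zdiffs_append)
  moreover have "a [^] (p ^ k) = \<one>"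
    using a(1) pow_order_eq_1 assms(3) by auto
  ultimately show ?thesis
    using prime_dvd_zdiffs_replicate[OF assms(1) a(1) assms(6)] by simp
qed

lemma prime_power_dvd_zdiffs_long:
  assumes "Factorial_Ring.prime p" "finite (carrier G)" "order G = p ^ k"
    and "set as \<subseteq> carrier G" "length as = n * (p ^ k * p ^ k)" "x \<in> carrier G"
  shows "int (p ^ n) dvd zdiffs G as f x"
  using assms(4-6)
proof (induction n arbitrary: as x)
  case (Suc n)
  let ?N = "p ^ k * p ^ k"
  let ?bs = "take ?N as" and ?cs = "drop ?N as"
  \<comment> \<open>The quotient is exact on the carrier by the induction hypothesis, so the outer
    block \<open>?bs\<close> acts on an integer-valued map and contributes one more factor
    \<open>p\<close>.\<close>
  let ?g = "\<lambda>y. zdiffs G ?cs f y div int (p ^ n)"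
  have cs: "set ?cs \<subseteq> carrier G" and bs: "set ?bs \<subseteq> carrier G"
    using Suc.prems(1) by (auto dest: in_set_dropD in_set_takeD)
  have "zdiffs G as f x = zdiffs G ?bs (zdiffs G ?cs f) x"
    by (simp flip: zdiffs_append)
  also have "\<dots> = zdiffs G ?bs (\<lambda>y. int (p ^ n) * ?g y) x"
    using Suc.prems Suc.IH[OF cs] by (intro zdiffs_cong[OF bs]) auto
  also have "\<dots> = int (p ^ n) * zdiffs G ?bs ?g x"
    by (rule zdiffs_cmult)
  finally show ?case
    using prime_dvd_zdiffs_long[OF assms(1-3) bs, of x ?g] Suc.prems
    by (auto simp: mult.commute[of "int p"] intro: mult_dvd_mono)
qed simp

text \<open>Differences commute, so the generators can be exchanged for arbitrary
  group elements one position at a time.\<close>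
lemma dvd_zdiffs_from_generators:
  assumes gen: "\<And>g. (\<And>s x. s \<in> S \<Longrightarrow> x \<in> carrier G \<Longrightarrow> m dvd zdiff G s g x) \<Longrightarrow>
      (\<And>a x. a \<in> carrier G \<Longrightarrow> x \<in> carrier G \<Longrightarrow> m dvd zdiff G a g x)"
    and "S \<subseteq> carrier G"
    and "\<And>ss x. set ss \<subseteq> S \<Longrightarrow> length ss = n \<Longrightarrow> x \<in> carrier G \<Longrightarrow> m dvd zdiffs G ss f x"
    and "set as \<subseteq> carrier G" "length as = n" "x \<in> carrier G"
  shows "m dvd zdiffs G as f x"
  using assms(3-6)
proof (induction n arbitrary: f as x)
  case (Suc n)
  from Suc.prems(3) obtain b bs where as: "as = b # bs" "length bs = n"
    by (auto simp: length_Suc_conv)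
  have bs: "set bs \<subseteq> carrier G" and b: "b \<in> carrier G"
    using Suc.prems(2) as by auto
  have "m dvd zdiff G s (zdiffs G bs f) y" if s: "s \<in> S" and y: "y \<in> carrier G" for s y
  proof -
    have "m dvd zdiffs G bs (zdiff G s f) y"
    proof (rule Suc.IH[OF _ bs as(2) y])
      fix ss z assume "set ss \<subseteq> S" "length ss = n" "z \<in> carrier G"
      then show "m dvd zdiffs G ss (zdiff G s f) z"
        using Suc.prems(1)[of "s # ss" z] s assms(2) by (subst zdiffs_zdiff_commute) auto
    qed
    then show ?thesis
      using zdiffs_zdiff_commute[OF bs _ y, of s f] s assms(2) by auto
  qed
  then show ?case
    using gen b Suc.prems(4) as(1) by simp
qed auto

text \<open>The powers of the augmentation ideal decrease: a value of \<open>zdiff\<close> is a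
  difference of two values of the shorter iterate, so \<open>m\<close> cannot divide both without
  dividing it.\<close>

lemma survives_antimono:
  assumes "survives G m n" "k \<le> n"
  shows "survives G m k"
  using assms
proof (induction n)
  case (Suc n)
  have "survives G m n"
  proof -
    from Suc.prems obtain a as x z where *: "length as = n" "set (a # as) \<subseteq> carrier G"
      "x \<in> carrier G" "z \<in> carrier G" "\<not> m dvd zdiffs G (a # as) (point z) x"
      unfolding survives_def by (auto simp: length_Suc_conv)
    then have "\<not> m dvd zdiffs G as (point z) (x \<otimes> a) \<or> \<not> m dvd zdiffs G as (point z) x"
      by (auto simp: zdiff_def)
    with * show ?thesis unfolding survives_def by (metis list.set_intros(2) m_closed list.set_intros(1) subset_code(1))
  qed
  with Suc show ?case by (cases "k = Suc n") auto
qed simp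

lemma survives_0:
  assumes "\<not> m dvd 1"
  shows "survives G m 0"
  using assms unfolding survives_def by (force simp: point_def intro: bexI[of _ \<one>])

text \<open>The augmentation ideal is nilpotent modulo \<open>p ^ n\<close>; this makes a largest
  surviving length exist.\<close>

lemma survives_bounded:
  assumes "Factorial_Ring.prime p" "finite (carrier G)" "order G = p ^ k" "survives G (int (p ^ n)) l"
  shows "l < n * (p ^ k * p ^ k)"
proof (rule ccontr)
  assume "\<not> ?thesis"
  then have "survives G (int (p ^ n)) (n * (p ^ k * p ^ k))"
    using survives_antimono[OF assms(4)] by simp
  then show False
    using prime_power_dvd_zdiffs_long[OF assms(1-3)] unfolding survives_def by blast
qed

end

section \<open>Functional degree of maps into \<open>B\<close> through integer coefficients\<close>

text \<open>\<open>f\<close> is the combination of the maps \<open>point z\<close> with coefficients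
  \<open>f z\<close> in \<open>B\<close>, and differences are additive, so they act on the point
  maps only. As \<open>B\<close> is multiplicative, the integers appear as exponents.\<close>

lemma diffops_eq_finprod:
  assumes "comm_group A" "finite (carrier A)" "comm_group B" "f \<in> carrier A \<rightarrow> carrier B"
    and "set as \<subseteq> carrier A" "y \<in> carrier A"
  shows "diffops A B as f y = finprod B (\<lambda>z. f z [^]\<^bsub>B\<^esub> zdiffs A as (point z) y) (carrier A)"
  using assms(5,6)
proof (induction as arbitrary: y)
  case Nil
  interpret B: comm_group B by fact
  have "finprod B (\<lambda>z. f z [^]\<^bsub>B\<^esub> point z y) (carrier A)
      = finprod B (\<lambda>z. if y = z then f z else \<one>\<^bsub>B\<^esub>) (carrier A)"
    using assms(4) by (intro B.finprod_cong') (auto simp: point_def Pi_iff)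
  also have "\<dots> = f y"
    using assms Nil by (intro B.finprod_singleton) auto
  finally show ?case by simp
next
  case (Cons a as)
  interpret A: comm_group A by fact
  interpret B: comm_group B by fact
  let ?F = "\<lambda>y z. f z [^]\<^bsub>B\<^esub> zdiffs A as (point z) y"
  have F: "?F y \<in> carrier A \<rightarrow> carrier B" for y
    using assms(4) by auto
  have ya: "y \<otimes>\<^bsub>A\<^esub> a \<in> carrier A" using Cons by auto
  have "finprod B (\<lambda>z. f z [^]\<^bsub>B\<^esub> zdiffs A (a # as) (point z) y) (carrier A) \<otimes>\<^bsub>B\<^esub> finprod B (?F y) (carrier A)
    = finprod B (\<lambda>z. f z [^]\<^bsub>B\<^esub> zdiffs A (a # as) (point z) y \<otimes>\<^bsub>B\<^esub> ?F y z) (carrier A)"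
    using assms(4) by (intro B.finprod_multf[symmetric]) auto
  also have "\<dots> = finprod B (?F (y \<otimes>\<^bsub>A\<^esub> a)) (carrier A)"
    using assms(4) by (intro B.finprod_cong') (auto simp: zdiff_def Pi_iff simp flip: B.int_pow_mult)
  finally have "finprod B (\<lambda>z. f z [^]\<^bsub>B\<^esub> zdiffs A (a # as) (point z) y) (carrier A)
      = finprod B (?F (y \<otimes>\<^bsub>A\<^esub> a)) (carrier A) \<otimes>\<^bsub>B\<^esub> inv\<^bsub>B\<^esub> finprod B (?F y) (carrier A)"
    using F assms(4) by (intro B.inv_solve_right[THEN iffD2] B.finprod_closed) auto
  then show ?case
    using Cons ya by (simp add: diffop_def)
qed

text \<open>A zero map stays zero under further differences, so \<open>kills A B f n\<close> with
  \<open>n < length as\<close> would annihilate the iterate along \<open>as\<close>. For the same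
  reason \<open>f\<close> is nonzero, which excludes \<open>-\<infinity>\<close>.\<close>

lemma fdeg_ge:
  assumes "comm_group A" "comm_group B" "set as \<subseteq> carrier A" "\<not> is_zero_map A B (diffops A B as f)"
  shows "fdeg A B f \<ge> ereal (real (length as))"
proof -
  interpret A: comm_group A by fact
  interpret B: comm_group B by fact
  have zero: "is_zero_map A B (diffops A B (us @ vs) f)"
    if "is_zero_map A B (diffops A B vs f)" "set us \<subseteq> carrier A" for us vs
    using that(2) by (induction us) (use that(1) in \<open>auto simp: is_zero_map_def diffop_def\<close>)
  have "\<not> is_zero_map A B f"
    using zero[of "[]" as] assms(3,4) by auto
  moreover have "length as \<le> n" if "kills A B f n" for n
  proof (rule ccontr)
    assume "\<not> length as \<le> n"
    \<comment> \<open>The last entries of the list act first, hence the suffix of length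
      \<open>Suc n\<close> is the part to which \<open>kills\<close> applies.\<close>
    then have "length (drop (length as - Suc n) as) = Suc n" by simp
    moreover have "set (drop (length as - Suc n) as) \<subseteq> carrier A"
      using assms(3) by (auto dest: in_set_dropD)
    ultimately have "is_zero_map A B (diffops A B (drop (length as - Suc n) as) f)"
      using that unfolding kills_def by blast
    moreover have "set (take (length as - Suc n) as) \<subseteq> carrier A"
      using assms(3) by (auto dest: in_set_takeD)
    ultimately show False
      using zero assms(4) by (metis append_take_drop_id)
  qed
  ultimately show ?thesis
    by (auto simp: fdeg_def intro: LeastI2)
qed

lemma fdeg_le:
  assumes "kills A B f n"
  shows "fdeg A B f \<le> ereal (real n)"
  using assms by (auto simp: fdeg_def intro: Least_le)

text \<open>Of \<open>B\<close> only the set of integers annihilating it matters, here the multiples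
  of \<open>e\<close>. In this form the lemma covers both the given group and the cyclic groups of
  the formula.\<close>

lemma delta_eq_survives:
  assumes "comm_group A" "finite (carrier A)" "comm_group B"
    and exponent: "\<And>m::int. (\<forall>b\<in>carrier B. b [^]\<^bsub>B\<^esub> m = \<one>\<^bsub>B\<^esub>) \<longleftrightarrow> e dvd m"
    and "survives A e n" "\<not> survives A e (Suc n)"
  shows "delta A B = ereal (real n)"
proof (rule antisym)
  interpret A: comm_group A by fact
  interpret B: comm_group B by fact
  show "delta A B \<le> ereal (real n)"
    unfolding delta_def
  proof (rule SUP_least, rule fdeg_le)
    fix f assume f: "f \<in> carrier A \<rightarrow>\<^sub>E carrier B"
    then have f': "f \<in> carrier A \<rightarrow> carrier B" by auto
    show "kills A B f n"
      unfolding kills_def is_zero_map_def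
    proof (intro allI impI ballI)
      fix as y assume as: "length as = Suc n \<and> set as \<subseteq> carrier A" and y: "y \<in> carrier A"
      have "f z [^]\<^bsub>B\<^esub> zdiffs A as (point z) y = \<one>\<^bsub>B\<^esub>" if "z \<in> carrier A" for z
      proof -
        have "e dvd zdiffs A as (point z) y"
          using assms(6) as y that unfolding survives_def by blast
        then show ?thesis using exponent f' that by blast
      qed
      then show "diffops A B as f y = \<one>\<^bsub>B\<^esub>"
        using as y by (simp add: diffops_eq_finprod[OF assms(1-3) f'] B.finprod_one_eqI)
    qed
  qed
  from assms(5) obtain as x z where w: "length as = n" "set as \<subseteq> carrier A" "x \<in> carrier A"
    "z \<in> carrier A" "\<not> e dvd zdiffs A as (point z) x"
    unfolding survives_def by blast
  then obtain b where b: "b \<in> carrier B" "b [^]\<^bsub>B\<^esub> zdiffs A as (point z) x \<noteq> \<one>\<^bsub>B\<^esub>"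
    using exponent by blast
  \<comment> \<open>A map supported at \<open>z\<close> isolates one coefficient in the product
    formula, and \<open>b\<close> is an element which that coefficient does not annihilate.\<close>
  define f where "f = (\<lambda>y\<in>carrier A. if y = z then b else \<one>\<^bsub>B\<^esub>)"
  have f: "f \<in> carrier A \<rightarrow>\<^sub>E carrier B" and f': "f \<in> carrier A \<rightarrow> carrier B"
    using b(1) by (auto simp: f_def)
  have "diffops A B as f x = finprod B (\<lambda>y. f y [^]\<^bsub>B\<^esub> zdiffs A as (point y) x) (carrier A)"
    by (rule diffops_eq_finprod[OF assms(1-3) f' w(2,3)])
  also have "\<dots> = finprod B (\<lambda>y. if z = y then b [^]\<^bsub>B\<^esub> zdiffs A as (point y) x else \<one>\<^bsub>B\<^esub>) (carrier A)"
    using b(1) by (intro B.finprod_cong') (auto simp: f_def)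
  also have "\<dots> = b [^]\<^bsub>B\<^esub> zdiffs A as (point z) x"
    using b(1) w(4) assms(2) by (intro B.finprod_singleton) auto
  finally have "\<not> is_zero_map A B (diffops A B as f)"
    using b(2) w(3) by (auto simp: is_zero_map_def intro!: bexI[of _ x])
  then have "ereal (real n) \<le> fdeg A B f"
    using fdeg_ge[OF assms(1,3) w(2)] w(1) by blast
  also have "\<dots> \<le> delta A B"
    unfolding delta_def using f by (rule SUP_upper)
  finally show "ereal (real n) \<le> delta A B" .
qed


section \<open>Finite direct sums and pure tensors\<close>

locale finite_direct_sum =
  fixes I :: "'i set" and G :: "'i \<Rightarrow> ('a, 'c) monoid_scheme"
  assumes finite_index: "finite I"
    and comm_group_summand: "\<And>i. i \<in> I \<Longrightarrow> comm_group (G i)"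
begin

abbreviation S :: "('i \<Rightarrow> 'a) monoid" where "S \<equiv> sum_group I G"

definition inc :: "'i \<Rightarrow> 'a \<Rightarrow> 'i \<Rightarrow> 'a"
  where "inc i a = (\<lambda>j\<in>I. if j = i then a else \<one>\<^bsub>G j\<^esub>)"

lemma group_summand: "i \<in> I \<Longrightarrow> group (G i)"
  using comm_group_summand comm_group.axioms(2) by blast

lemma carrier_S: "carrier S = (\<Pi>\<^sub>E i\<in>I. carrier (G i))"
  using finite_index by (auto simp: carrier_sum_group group_summand)

lemma comm_group_S: "comm_group S"
proof (rule group.group_comm_groupI)
  show "group S" by (simp add: group_summand)
  fix x y assume "x \<in> carrier S" "y \<in> carrier S"
  then show "x \<otimes>\<^bsub>S\<^esub> y = y \<otimes>\<^bsub>S\<^esub> x"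
    using comm_group_summand
    by (auto simp: carrier_S fun_eq_iff PiE_iff intro!: comm_monoid.m_comm comm_group.axioms(1))
qed

sublocale S: comm_group S
  by (rule comm_group_S)

lemma one_in_summand: "i \<in> I \<Longrightarrow> \<one>\<^bsub>G i\<^esub> \<in> carrier (G i)"
  using group_summand[THEN group.is_monoid] by (rule monoid.one_closed)

lemma inc_closed: "i \<in> I \<Longrightarrow> a \<in> carrier (G i) \<Longrightarrow> inc i a \<in> carrier S"
  using one_in_summand by (auto simp: carrier_S inc_def)

lemma mult_inc:
  assumes "x \<in> carrier S" "i \<in> I"
  shows "x \<otimes>\<^bsub>S\<^esub> inc i a = x(i := x i \<otimes>\<^bsub>G i\<^esub> a)"
proof
  fix j
  show "(x \<otimes>\<^bsub>S\<^esub> inc i a) j = (x(i := x i \<otimes>\<^bsub>G i\<^esub> a)) j"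
    using assms group_summand[THEN group.is_monoid, of j]
    by (auto simp: carrier_S inc_def PiE_iff extensional_def monoid.r_one)
qed

lemma dvd_zdiff_of_inc:
  assumes inv: "\<And>i a x. i \<in> I \<Longrightarrow> a \<in> carrier (G i) \<Longrightarrow> x \<in> carrier S \<Longrightarrow> m dvd zdiff S (inc i a) g x"
    and a: "a \<in> carrier S" and x: "x \<in> carrier S"
  shows "m dvd zdiff S a g x"
proof -
  define part where "part J = (\<lambda>i\<in>I. if i \<in> J then a i else \<one>\<^bsub>G i\<^esub>)" for J
  have part: "part J \<in> carrier S" for J
    using a one_in_summand by (auto simp: part_def carrier_S)
  have "finite J \<Longrightarrow> J \<subseteq> I \<Longrightarrow> m dvd zdiff S (part J) g x" for J
  proof (induction J rule: finite_induct)
    case empty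
    have "part {} = \<one>\<^bsub>S\<^esub>" by (simp add: part_def)
    then show ?case using x S.r_one[OF x] by (simp only: zdiff_def) simp
  next
    case (insert i J)
    have i: "i \<in> I" "a i \<in> carrier (G i)"
      using insert a by (auto simp: carrier_S)
    have "part (insert i J) = part J \<otimes>\<^bsub>S\<^esub> inc i (a i)"
      using i insert.hyps group_summand[OF i(1), THEN group.is_monoid]
      by (subst mult_inc[OF part i(1)]) (auto simp: part_def fun_eq_iff monoid.l_one)
    then have "zdiff S (part (insert i J)) g x
        = zdiff S (inc i (a i)) g (x \<otimes>\<^bsub>S\<^esub> part J) + zdiff S (part J) g x"
      using x part[of J] inc_closed[OF i] by (simp only: zdiff_def S.m_assoc)
    moreover have "m dvd zdiff S (inc i (a i)) g (x \<otimes>\<^bsub>S\<^esub> part J)"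
      using inv i S.m_closed[OF x part] by blast
    ultimately show ?case using insert by (simp only:) (blast intro: dvd_add)
  qed
  moreover have "part I = a"
    using a by (auto simp: part_def carrier_S fun_eq_iff PiE_iff extensional_def)
  ultimately show ?thesis using finite_index by blast
qed

text \<open>A point map on \<open>S\<close> is the product of point maps on the summands, and a
  difference along the embedded \<open>G i\<close> changes the factor at \<open>i\<close> alone. The
  tags in \<open>ps\<close> record the factor to which each difference belongs.\<close>

lemma zdiffs_inc:
  assumes "\<forall>(i, a) \<in> set ps. i \<in> I \<and> a \<in> carrier (G i)" "x \<in> carrier S" "z \<in> carrier S"
  shows "zdiffs S (map (\<lambda>(i, a). inc i a) ps) (point z) x
    = (\<Prod>i\<in>I. zdiffs (G i) (map snd (filter (\<lambda>q. fst q = i) ps)) (point (z i)) (x i))"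
  using assms(1,2)
proof (induction ps arbitrary: x)
  case Nil
  have "x = z \<longleftrightarrow> (\<forall>i\<in>I. x i = z i)"
    using Nil assms(3) by (auto simp: carrier_S intro: PiE_ext)
  then show ?case
    using finite_index by (auto simp: point_def)
next
  case (Cons q ps)
  obtain i a where q: "q = (i, a)" by (cases q)
  let ?f = "\<lambda>j y. zdiffs (G j) (map snd (filter (\<lambda>q. fst q = j) ps)) (point (z j)) y"
  let ?f' = "\<lambda>j y. zdiffs (G j) (map snd (filter (\<lambda>q. fst q = j) (q # ps))) (point (z j)) y"
  have i: "i \<in> I" "a \<in> carrier (G i)" using Cons.prems q by auto
  have xi: "x \<otimes>\<^bsub>S\<^esub> inc i a \<in> carrier S"
    using Cons.prems(2) inc_closed[OF i] by (rule S.m_closed)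
  have split: "(\<Prod>j\<in>I. h j) = h i * (\<Prod>j\<in>I - {i}. h j)" for h :: "'i \<Rightarrow> int"
    using finite_index i(1) by (rule prod.remove)
  have "zdiffs S (map (\<lambda>(i, a). inc i a) (q # ps)) (point z) x
      = (\<Prod>j\<in>I. ?f j ((x \<otimes>\<^bsub>S\<^esub> inc i a) j)) - (\<Prod>j\<in>I. ?f j (x j))"
    using Cons.IH[OF _ xi] Cons.IH[OF _ Cons.prems(2)] Cons.prems(1) by (simp add: q zdiff_def del: mult_sum_group)
  also have "\<dots> = (\<Prod>j\<in>I. ?f j ((x(i := x i \<otimes>\<^bsub>G i\<^esub> a)) j)) - (\<Prod>j\<in>I. ?f j (x j))"
    using mult_inc[OF Cons.prems(2) i(1)] by simp
  also have "\<dots> = (?f i (x i \<otimes>\<^bsub>G i\<^esub> a) - ?f i (x i)) * (\<Prod>j\<in>I - {i}. ?f j (x j))"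
    by (subst (1 2) split) (simp add: left_diff_distrib)
  also have "\<dots> = (\<Prod>j\<in>I. ?f' j (x j))"
    by (subst split) (auto simp: q zdiff_def intro!: prod.cong)
  finally show ?case .
qed

text \<open>Arbitrary differences are exchanged for differences along embedded summands, which are
  then sorted by summand.\<close>

lemma survives_S_iff:
  "survives S m n \<longleftrightarrow> (\<exists>as. (\<forall>i\<in>I. set (as i) \<subseteq> carrier (G i)) \<and> (\<Sum>i\<in>I. length (as i)) = n \<and>
     (\<exists>x\<in>carrier S. \<exists>z\<in>carrier S. \<not> m dvd (\<Prod>i\<in>I. zdiffs (G i) (as i) (point (z i)) (x i))))"
  (is "_ \<longleftrightarrow> ?R")
proof
  assume "survives S m n"
  then obtain bs x z where bs: "length bs = n" "set bs \<subseteq> carrier S" "x \<in> carrier S" "z \<in> carrier S"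
    "\<not> m dvd zdiffs S bs (point z) x"
    unfolding survives_def by blast
  let ?P = "SIGMA i:I. carrier (G i)"
  let ?T = "(\<lambda>(i, a). inc i a) ` ?P"
  have "\<exists>ss y. set ss \<subseteq> ?T \<and> length ss = n \<and> y \<in> carrier S \<and> \<not> m dvd zdiffs S ss (point z) y"
  proof (rule ccontr)
    assume none: "\<not> ?thesis"
    have "m dvd zdiffs S bs (point z) x"
    proof (rule S.dvd_zdiffs_from_generators[where S = ?T])
      show "m dvd zdiff S a g y"
        if "\<And>s y. s \<in> ?T \<Longrightarrow> y \<in> carrier S \<Longrightarrow> m dvd zdiff S s g y" "a \<in> carrier S" "y \<in> carrier S" for a g y
        using that(2,3) by (rule dvd_zdiff_of_inc[rotated]) (use that(1) in blast)
      show "?T \<subseteq> carrier S"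
        using inc_closed by auto
    qed (use bs none in blast)+
    with bs(5) show False by blast
  qed
  then obtain ss y where ss: "ss \<in> lists ?T" "length ss = n" "y \<in> carrier S"
    "\<not> m dvd zdiffs S ss (point z) y"
    by auto
  from ss(1) obtain ps where ps: "ss = map (\<lambda>(i, a). inc i a) ps" "set ps \<subseteq> ?P"
    by (auto simp: lists_image)
  let ?as = "\<lambda>i. map snd (filter (\<lambda>q. fst q = i) ps)"
  have "length ps = (\<Sum>i\<in>I. length (?as i))"
    using ps(2)
  proof (induction ps)
    case (Cons q ps)
    have "(\<Sum>i\<in>I. length (map snd (filter (\<lambda>q. fst q = i) (q # ps))))
        = (\<Sum>i\<in>I. (if fst q = i then 1 else 0) + length (map snd (filter (\<lambda>q. fst q = i) ps)))"
      by (rule sum.cong) auto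
    then show ?case using Cons finite_index by (auto simp: sum.distrib)
  qed simp
  moreover have "zdiffs S ss (point z) y = (\<Prod>i\<in>I. zdiffs (G i) (?as i) (point (z i)) (y i))"
    unfolding ps(1) using ps(2) ss(3) bs(4) by (intro zdiffs_inc) auto
  moreover have "\<forall>i\<in>I. set (?as i) \<subseteq> carrier (G i)"
    using ps(2) by auto
  ultimately show ?R
    using ss ps(1) bs(4) by (intro exI[of _ ?as]) auto
next
  assume ?R
  then obtain as x z where as: "\<forall>i\<in>I. set (as i) \<subseteq> carrier (G i)" "(\<Sum>i\<in>I. length (as i)) = n"
    "x \<in> carrier S" "z \<in> carrier S"
    "\<not> m dvd (\<Prod>i\<in>I. zdiffs (G i) (as i) (point (z i)) (x i))"
    by blast
  obtain js where js: "set js = I" "distinct js"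
    using finite_distinct_list[OF finite_index] by blast
  \<comment> \<open>The lists are tagged and joined in the order of \<open>js\<close>; as
    \<open>js\<close> is distinct, selecting the tag \<open>i\<close> returns exactly
    \<open>as i\<close>.\<close>
  define ps where "ps = concat (map (\<lambda>i. map (Pair i) (as i)) js)"
  have "map snd (filter (\<lambda>q. fst q = i) (concat (map (\<lambda>i. map (Pair i) (as i)) ks)))
      = (if i \<in> set ks then as i else [])" if "distinct ks" for i ks
    using that by (induction ks) (auto simp: filter_map o_def filter_empty_conv)
  then have sel: "map snd (filter (\<lambda>q. fst q = i) ps) = as i" if "i \<in> I" for i
    using that js by (simp add: ps_def)
  let ?ss = "map (\<lambda>(i, a). inc i a) ps"
  have ps: "\<forall>(i, a) \<in> set ps. i \<in> I \<and> a \<in> carrier (G i)"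
    using as(1) js by (auto simp: ps_def)
  have "length ?ss = n"
    using js as(2) by (simp add: ps_def length_concat o_def sum_list_distinct_conv_sum_set)
  moreover have "set ?ss \<subseteq> carrier S"
    using ps inc_closed by auto
  moreover have "\<not> m dvd zdiffs S ?ss (point z) x"
    using as(5) sel by (simp add: zdiffs_inc[OF ps as(3,4)])
  ultimately show "survives S m n"
    unfolding survives_def using as(3,4) by blast
qed

text \<open>Valuations of the factors add up, and non-divisibility by \<open>p ^ Suc k\<close> means
  valuation at most \<open>k\<close>; so the bound \<open>k\<close> on the sum can be split into
  bounds \<open>bs i\<close> on the summands.\<close>

lemma survives_S_prime_power_iff:
  assumes "Factorial_Ring.prime p" "I \<noteq> {}"
  shows "survives S (int (p ^ Suc k)) n \<longleftrightarrow>
    (\<exists>ns bs. (\<Sum>i\<in>I. ns i) = n \<and> (\<Sum>i\<in>I. bs i) = k \<and>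
      (\<forall>i\<in>I. survives (G i) (int (p ^ Suc (bs i))) (ns i)))"
proof -
  let ?p = "int p"
  have p: "prime_elem ?p" "\<not> is_unit ?p"
    using assms(1) by (auto simp: prime_imp_prime_elem)
  have nd: "\<not> ?p ^ Suc k dvd t \<longleftrightarrow> t \<noteq> 0 \<and> multiplicity ?p t \<le> k" for t k
    using p power_dvd_iff_le_multiplicity[of t ?p "Suc k"] by (cases "t = 0") auto
  have prod: "\<not> ?p ^ Suc k dvd (\<Prod>i\<in>I. t i) \<longleftrightarrow>
      (\<exists>bs. (\<Sum>i\<in>I. bs i) = k \<and> (\<forall>i\<in>I. \<not> ?p ^ Suc (bs i) dvd t i))" for t
  \<comment> \<open>A zero factor is treated apart: every power divides 0, while
    \<open>multiplicity\<close> takes the default value 0 there.\<close>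
  proof (cases "0 \<in> t ` I")
    case True
    then have "(\<Prod>i\<in>I. t i) = 0" using finite_index by (auto simp: prod_zero_iff)
    with True show ?thesis by force
  next
    case False
    have mult: "multiplicity ?p (\<Prod>i\<in>I. t i) = (\<Sum>i\<in>I. multiplicity ?p (t i))"
      using False finite_index p by (intro prime_elem_multiplicity_prod_distrib) auto
    have nz: "(\<Prod>i\<in>I. t i) \<noteq> 0"
      using False finite_index by (auto simp: prod_zero_iff)
    have "(\<Sum>i\<in>I. v i) \<le> k \<longleftrightarrow> (\<exists>bs. (\<Sum>i\<in>I. bs i) = k \<and> (\<forall>i\<in>I. v i \<le> bs i))" for v :: "'i \<Rightarrow> nat"
    proof
      assume le: "(\<Sum>i\<in>I. v i) \<le> k"
      obtain i0 where i0: "i0 \<in> I" using assms(2) by blast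
      \<comment> \<open>All the slack goes to the single index \<open>i0\<close>, which makes the
        total exactly \<open>k\<close>; this is where \<open>I \<noteq> {}\<close> enters.\<close>
      let ?b = "\<lambda>i. v i + (if i = i0 then k - (\<Sum>i\<in>I. v i) else 0)"
      have "(\<Sum>i\<in>I. ?b i) = k"
        using le i0 finite_index by (simp add: sum.distrib)
      then show "\<exists>bs. (\<Sum>i\<in>I. bs i) = k \<and> (\<forall>i\<in>I. v i \<le> bs i)"
        by (intro exI[of _ ?b]) auto
    qed (auto intro: sum_mono)
    then show ?thesis
      unfolding nd mult using nz False by (auto simp: image_iff)
  qed
  show ?thesis
  proof
    assume "survives S (int (p ^ Suc k)) n"
    then obtain as x z bs where *: "\<forall>i\<in>I. set (as i) \<subseteq> carrier (G i)" "(\<Sum>i\<in>I. length (as i)) = n"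
      "x \<in> carrier S" "z \<in> carrier S" "(\<Sum>i\<in>I. bs i) = k"
      "\<forall>i\<in>I. \<not> ?p ^ Suc (bs i) dvd zdiffs (G i) (as i) (point (z i)) (x i)"
      unfolding survives_S_iff of_nat_power prod by blast
    then have "\<forall>i\<in>I. survives (G i) (int (p ^ Suc (bs i))) (length (as i))"
      unfolding survives_def of_nat_power carrier_S by (blast dest: PiE_mem)
    with * show "\<exists>ns bs. (\<Sum>i\<in>I. ns i) = n \<and> (\<Sum>i\<in>I. bs i) = k \<and>
      (\<forall>i\<in>I. survives (G i) (int (p ^ Suc (bs i))) (ns i))"
      by (intro exI[of _ "\<lambda>i. length (as i)"] exI[of _ bs]) auto
  next
    assume "\<exists>ns bs. (\<Sum>i\<in>I. ns i) = n \<and> (\<Sum>i\<in>I. bs i) = k \<and>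
      (\<forall>i\<in>I. survives (G i) (int (p ^ Suc (bs i))) (ns i))"
    then obtain ns bs where *: "(\<Sum>i\<in>I. ns i) = n" "(\<Sum>i\<in>I. bs i) = k"
      "\<forall>i\<in>I. survives (G i) (int (p ^ Suc (bs i))) (ns i)" by blast
    from *(3) obtain as x z where w: "\<forall>i\<in>I. length (as i) = ns i \<and> set (as i) \<subseteq> carrier (G i) \<and>
        x i \<in> carrier (G i) \<and> z i \<in> carrier (G i) \<and>
        \<not> ?p ^ Suc (bs i) dvd zdiffs (G i) (as i) (point (z i)) (x i)"
      unfolding survives_def of_nat_power by metis
    let ?x = "restrict x I" and ?z = "restrict z I"
    have "\<not> ?p ^ Suc k dvd (\<Prod>i\<in>I. zdiffs (G i) (as i) (point (?z i)) (?x i))"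
      unfolding prod using w *(2) by (intro exI[of _ bs]) auto
    moreover have "?x \<in> carrier S" "?z \<in> carrier S"
      using w by (auto simp: carrier_S)
    moreover have "(\<Sum>i\<in>I. length (as i)) = n"
      using w *(1) by simp
    ultimately show "survives S (int (p ^ Suc k)) n"
      unfolding survives_S_iff of_nat_power using w by blast
  qed
qed

end

section \<open>Integers annihilating a group\<close>

text \<open>If \<open>m\<close> annihilates \<open>B\<close>, so does its remainder modulo
  \<open>e\<close>, which must be 0 by minimality of the exponent. The condition
  \<open>e > 0\<close> excludes the default value 0 of \<open>group_exponent\<close>.\<close>

lemma group_exponent_dvd:
  assumes "group B" "group_exponent B = e" "e > 0"
  shows "(\<forall>b\<in>carrier B. b [^]\<^bsub>B\<^esub> (m::int) = \<one>\<^bsub>B\<^esub>) \<longleftrightarrow> int e dvd m"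
proof -
  interpret B: group B by fact
  let ?Q = "\<lambda>n. n > 0 \<and> (\<forall>x\<in>carrier B. x [^]\<^bsub>B\<^esub> (n::nat) = \<one>\<^bsub>B\<^esub>)"
  have ex: "\<exists>n. ?Q n" and e: "e = (LEAST n. ?Q n)"
    using assms(2,3) by (auto simp: group_exponent_def split: if_splits)
  have Qe: "?Q e" using LeastI_ex[OF ex] e by simp
  have pow: "b [^]\<^bsub>B\<^esub> m = b [^]\<^bsub>B\<^esub> nat (m mod int e)" if "b \<in> carrier B" for b
  proof -
    have "b [^]\<^bsub>B\<^esub> m = b [^]\<^bsub>B\<^esub> (int e * (m div int e) + m mod int e)" by simp
    also have "\<dots> = (b [^]\<^bsub>B\<^esub> int e) [^]\<^bsub>B\<^esub> (m div int e) \<otimes>\<^bsub>B\<^esub> b [^]\<^bsub>B\<^esub> (m mod int e)"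
      using that by (simp only: B.int_pow_mult B.int_pow_pow)
    also have "b [^]\<^bsub>B\<^esub> int e = \<one>\<^bsub>B\<^esub>" using Qe that by (simp add: int_pow_int)
    also have "b [^]\<^bsub>B\<^esub> (m mod int e) = b [^]\<^bsub>B\<^esub> nat (m mod int e)"
      using assms(3) by (subst int_pow_int[symmetric]) simp
    finally show ?thesis using that by simp
  qed
  show ?thesis
  proof
    assume "\<forall>b\<in>carrier B. b [^]\<^bsub>B\<^esub> m = \<one>\<^bsub>B\<^esub>"
    then have "\<forall>b\<in>carrier B. b [^]\<^bsub>B\<^esub> nat (m mod int e) = \<one>\<^bsub>B\<^esub>" by (simp add: pow)
    moreover have "nat (m mod int e) < e" using assms(3) by (simp add: nat_less_iff)
    ultimately have "\<not> nat (m mod int e) > 0"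
      using not_less_Least[of _ ?Q] e by blast
    then have "m mod int e = 0"
      using assms(3) pos_mod_sign[of "int e" m] by linarith
    then show "int e dvd m" by auto
  next
    assume "int e dvd m"
    then show "\<forall>b\<in>carrier B. b [^]\<^bsub>B\<^esub> m = \<one>\<^bsub>B\<^esub>" by (simp add: pow)
  qed
qed

text \<open>The residue 1, an element of the carrier because \<open>e > 1\<close>, is annihilated by
  the multiples of \<open>e\<close> only.\<close>

lemma integer_mod_group_pow_eq_one_iff:
  assumes "e > 1"
  shows "(\<forall>b\<in>carrier (integer_mod_group e). b [^]\<^bsub>integer_mod_group e\<^esub> (m::int) = \<one>\<^bsub>integer_mod_group e\<^esub>)
    \<longleftrightarrow> int e dvd m"
proof
  assume "\<forall>b\<in>carrier (integer_mod_group e). b [^]\<^bsub>integer_mod_group e\<^esub> m = \<one>\<^bsub>integer_mod_group e\<^esub>"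
  moreover have "1 \<in> carrier (integer_mod_group e)" using assms by simp
  ultimately have "1 [^]\<^bsub>integer_mod_group e\<^esub> m = \<one>\<^bsub>integer_mod_group e\<^esub>" by blast
  then show "int e dvd m" by (simp add: int_pow_integer_mod_group mod_eq_0_iff_dvd)
qed (simp add: int_pow_integer_mod_group mod_eq_0_iff_dvd)

theorem theorem4:
  fixes p \<beta> r :: nat
    and Ai :: "nat \<Rightarrow> ('a, 'c) monoid_scheme"
    and B :: "('b, 'd) monoid_scheme"
  assumes "Factorial_Ring.prime p" and "\<beta> \<ge> 1" and "r \<ge> 1"
    and "\<And>i. i < r \<Longrightarrow> comm_group (Ai i)"
    and "\<And>i. i < r \<Longrightarrow> finite (carrier (Ai i))"
    and "\<And>i. i < r \<Longrightarrow> \<exists>k. order (Ai i) = p ^ k"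
    and "\<And>i. i < r \<Longrightarrow> carrier (Ai i) \<noteq> {\<one>\<^bsub>Ai i\<^esub>}"
    and "comm_group B"
    and "group_exponent B = p ^ \<beta>"
  shows "delta (sum_group {..<r} Ai) B =
    Max ((\<lambda>bs. \<Sum>i<r. delta (Ai i) (integer_mod_group (p ^ (bs i + 1))))
          ` {bs \<in> {..<r} \<rightarrow>\<^sub>E (UNIV :: nat set). (\<Sum>i<r. bs i) = \<beta> - 1})"
proof -
  interpret finite_direct_sum "{..<r}" Ai
    using assms(4) by (intro finite_direct_sum.intro) auto
  have p1: "p > 1" using assms(1) by (rule prime_gt_1_nat)
  define T where "T = {bs \<in> {..<r} \<rightarrow>\<^sub>E (UNIV :: nat set). (\<Sum>i<r. bs i) = \<beta> - 1}"
  \<comment> \<open>By \<open>delta_i\<close> below, these are the degrees of the single summands;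
    as natural numbers they allow the maximum to be found before passing to
    \<open>ereal\<close>.\<close>
  define N where "N i k = (GREATEST n. survives (Ai i) (int (p ^ Suc k)) n)" for i k
  define M where "M = Max ((\<lambda>bs. \<Sum>i<r. N i (bs i)) ` T)"

  have nunit: "\<not> int (p ^ Suc k) dvd 1" for k
    using p1 by (simp del: power_Suc of_nat_power)
  have bound: "\<exists>L. \<forall>n. survives (Ai i) (int (p ^ Suc k)) n \<longrightarrow> n \<le> L" if "i < r" for i k
    using comm_group.survives_bounded[OF assms(4)[OF that] assms(1) assms(5)[OF that]] assms(6)[OF that]
    by (meson less_imp_le)
  have N_surv: "survives (Ai i) (int (p ^ Suc k)) (N i k)" if i: "i < r" for i k
  proof -
    obtain L where L: "\<forall>n. survives (Ai i) (int (p ^ Suc k)) n \<longrightarrow> n \<le> L"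
      using bound[OF i] by blast
    show ?thesis
      unfolding N_def
    proof (rule GreatestI_nat[where k = 0 and b = L])
      show "survives (Ai i) (int (p ^ Suc k)) 0"
        by (rule comm_group.survives_0[OF assms(4)[OF i] nunit])
    qed (use L in blast)
  qed
  have N_ge: "n \<le> N i k" if i: "i < r" and n: "survives (Ai i) (int (p ^ Suc k)) n" for i k n
  proof -
    obtain L where L: "\<forall>n. survives (Ai i) (int (p ^ Suc k)) n \<longrightarrow> n \<le> L"
      using bound[OF i] by blast
    show ?thesis
      unfolding N_def by (rule Greatest_le_nat[where b = L]) (use n L in blast)+
  qed
  have delta_i: "delta (Ai i) (integer_mod_group (p ^ (k + 1))) = ereal (real (N i k))" if "i < r" for i k
  proof (rule delta_eq_survives)
    show "\<And>m. (\<forall>b\<in>carrier (integer_mod_group (p ^ (k + 1))).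
        b [^]\<^bsub>integer_mod_group (p ^ (k + 1))\<^esub> m = \<one>\<^bsub>integer_mod_group (p ^ (k + 1))\<^esub>)
        \<longleftrightarrow> int (p ^ Suc k) dvd m"
      using integer_mod_group_pow_eq_one_iff[of "p ^ Suc k"] p1 by (metis Suc_eq_plus1 one_less_power zero_less_Suc)
    show "\<not> survives (Ai i) (int (p ^ Suc k)) (Suc (N i k))"
      using N_ge[OF that] by (meson not_less_eq_eq order_refl)
  qed (use that in \<open>simp_all only: assms(4,5) N_surv abelian_integer_mod_group\<close>)

  have "T \<subseteq> {..<r} \<rightarrow>\<^sub>E {..\<beta> - 1}"
  proof
    fix bs assume bs: "bs \<in> T"
    have "bs i \<le> \<beta> - 1" if "i < r" for i
      using bs member_le_sum[of i "{..<r}" bs] that by (auto simp: T_def)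
    with bs show "bs \<in> {..<r} \<rightarrow>\<^sub>E {..\<beta> - 1}" by (auto simp: T_def PiE_iff)
  qed
  then have finT: "finite T"
    by (rule finite_subset) (intro finite_PiE; simp)
  \<comment> \<open>The whole of \<open>\<beta> - 1\<close> is placed on the index 0, which exists
    since \<open>r \<ge> 1\<close>.\<close>
  have "(\<lambda>i\<in>{..<r}. if i = 0 then \<beta> - 1 else 0) \<in> T"
    using assms(3) by (auto simp: T_def)
  then have neT: "T \<noteq> {}" by blast

  have surv_iff: "survives S (int (p ^ \<beta>)) n \<longleftrightarrow>
      (\<exists>ns bs. (\<Sum>i<r. ns i) = n \<and> (\<Sum>i<r. bs i) = \<beta> - 1 \<and>
        (\<forall>i<r. survives (Ai i) (int (p ^ Suc (bs i))) (ns i)))" for n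
  proof -
    have "{..<r} \<noteq> {}" using assms(3) by (auto simp: lessThan_empty_iff)
    from survives_S_prime_power_iff[OF assms(1) this, of "\<beta> - 1" n] show ?thesis
      using assms(2) by (simp add: Ball_def)
  qed
  have "M \<in> (\<lambda>bs. \<Sum>i<r. N i (bs i)) ` T"
    unfolding M_def using finT neT by (intro Max_in) auto
  then obtain bs where "bs \<in> T" "M = (\<Sum>i<r. N i (bs i))" by blast
  then have survM: "survives S (int (p ^ \<beta>)) M"
    unfolding surv_iff using N_surv
    by (intro exI[of _ "\<lambda>i. N i (bs i)"] exI[of _ bs]) (auto simp: T_def)
  have maxM: "n \<le> M" if "survives S (int (p ^ \<beta>)) n" for n
  proof -
    from that obtain ns bs where *: "(\<Sum>i<r. ns i) = n" "(\<Sum>i<r. bs i) = \<beta> - 1"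
      "\<forall>i<r. survives (Ai i) (int (p ^ Suc (bs i))) (ns i)"
      unfolding surv_iff by blast
    \<comment> \<open>Members of \<open>T\<close> are extensional; restricting leaves all sums over
      \<open>{..<r}\<close> unchanged.\<close>
    let ?bs = "restrict bs {..<r}"
    have "?bs \<in> T" using *(2) by (auto simp: T_def)
    have "n \<le> (\<Sum>i<r. N i (?bs i))"
      using *(3) N_ge by (auto simp flip: *(1) intro!: sum_mono)
    also have "\<dots> \<le> M"
      unfolding M_def using finT \<open>?bs \<in> T\<close> by (intro Max_ge finite_imageI imageI)
    finally show ?thesis .
  qed
  have "delta S B = ereal (real M)"
  proof (rule delta_eq_survives[OF comm_group_S _ assms(8)])
    show "finite (carrier S)"
      unfolding carrier_S using assms(5) by (intro finite_PiE) auto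
    show "\<And>m. (\<forall>b\<in>carrier B. b [^]\<^bsub>B\<^esub> m = \<one>\<^bsub>B\<^esub>) \<longleftrightarrow> int (p ^ \<beta>) dvd m"
      using p1 by (intro group_exponent_dvd comm_group.axioms(2) assms) auto
    show "\<not> survives S (int (p ^ \<beta>)) (Suc M)"
      using maxM by (meson not_less_eq_eq order_refl)
  qed (rule survM)
  \<comment> \<open>The embedding of \<open>nat\<close> into \<open>ereal\<close> is monotone, so it
    commutes with the maximum of a finite nonempty set.\<close>
  also have "\<dots> = Max ((\<lambda>n. ereal (real n)) ` (\<lambda>bs. \<Sum>i<r. N i (bs i)) ` T)"
    unfolding M_def using finT neT by (intro mono_Max_commute) (auto simp: mono_def)
  also have "(\<lambda>n. ereal (real n)) ` (\<lambda>bs. \<Sum>i<r. N i (bs i)) ` T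
      = (\<lambda>bs. \<Sum>i<r. delta (Ai i) (integer_mod_group (p ^ (bs i + 1)))) ` T"
  proof -
    have "ereal (real (\<Sum>i<r. N i (bs i)))
        = (\<Sum>i<r. delta (Ai i) (integer_mod_group (p ^ (bs i + 1))))" for bs
    proof -
      have "(\<Sum>i<r. delta (Ai i) (integer_mod_group (p ^ (bs i + 1)))) = (\<Sum>i<r. ereal (real (N i (bs i))))"
        by (rule sum.cong[OF refl], rule delta_i) simp
      then show ?thesis by simp
    qed
    then show ?thesis by (simp only: image_image)
  qed
  finally show ?thesis
    unfolding T_def .
qed

end
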